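(* Let $X$ be a real normed space and $K\subset X$ a closed convex pointed cone. Let $A,B,C,D\subset X$ be nonempty sets such that $D$ is weakly $K$-compact, $B$ is open (in the norm topology), and $$A+C\subset D+B+K.$$ Then $$A+\bigl(C\overset{\bullet}{-}D\bigr)\subset \operatorname{conv}B+K.$$
   Context: Sums of sets are Minkowski sums (a sum with the empty set is empty); $\operatorname{conv}$ is the convex hull. A cone $K$ is pointed if $K\cap(-K)=\{0\}$. For nonempty $C,D\subset X$, $C\overset{\bullet}{-}D=\{x\in X\mid x+D\subset C\}=\bigcap_{d\in D}(C-d)$. A nonempty set $D\subset X$ is called weakly $K$-compact if from every cover of $D$ by sets of the form $U+K$, with $U\subset X$ weakly open, one can extract a finite subcover. *)

theory Defs
  imports "HOL-Analysis.Analysis"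
begin

(* The sum of two sets is the Minkowski sum of HOL-Library.Set_Algebras.  The operations "-" and
   unary "-" on sets denote set difference and complement, hence the images below. *)

(* The coarsest topology making every continuous linear functional continuous. *)
definition weak_topology :: "'a::real_normed_vector topology" where
  "weak_topology =
     topology_generated_by {blinfun_apply f -` V | (f :: 'a \<Rightarrow>\<^sub>L real) V. open V}"

definition pointed :: "'a::real_vector set \<Rightarrow> bool" where
  "pointed K \<longleftrightarrow> K \<inter> uminus ` K = {0}"

definition minkowski_diff :: "'a::ab_group_add set \<Rightarrow> 'a set \<Rightarrow> 'a set" where
  "minkowski_diff C D = {x. (\<lambda>d. x + d) ` D \<subseteq> C}"

lemma minkowski_diff_eq_Inter: "minkowski_diff C D = (\<Inter>d\<in>D. (\<lambda>c. c - d) ` C)"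
  by (force simp: minkowski_diff_def image_iff algebra_simps)

definition weakly_K_compact :: "'a::real_normed_vector set \<Rightarrow> 'a set \<Rightarrow> bool" where
  "weakly_K_compact K D \<longleftrightarrow>
     D \<noteq> {} \<and>
     (\<forall>\<C>. \<C> \<subseteq> {U + K | U. openin weak_topology U} \<and> D \<subseteq> \<Union>\<C> \<longrightarrow>
        (\<exists>\<F>. \<F> \<subseteq> \<C> \<and> finite \<F> \<and> D \<subseteq> \<Union>\<F>))"

end

theory Submission
  imports Defs
begin

text \<open>If \<open>z = a + x\<close> with \<open>x + D \<subseteq> C\<close>, then \<open>z + D \<subseteq> D + B + K\<close>.  Were \<open>z\<close> outside the open convex set
  \<open>conv B + K\<close>, some continuous linear \<open>f\<close> would satisfy \<open>f z < f b + f k\<close> for all \<open>b\<close> in \<open>B\<close> and \<open>k\<close> in \<open>K\<close>, in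
  particular \<open>f \<ge> 0\<close> on \<open>K\<close>.  Writing \<open>z + d = d' + b + k\<close> gives \<open>f d' < f d\<close>, so \<open>f\<close> has no minimum on
  \<open>D\<close>, and the cover of \<open>D\<close> by the sets \<open>{f > f d} + K\<close> contradicts weak \<open>K\<close>-compactness.  The
  separating functional comes from the Hahn-Banach theorem, in the form that a minimal sublinear
  functional is linear.\<close>

section \<open>Sublinear functionals and the Hahn-Banach theorem\<close>

definition sublinear :: "('a::real_vector \<Rightarrow> real) \<Rightarrow> bool" where
  "sublinear p \<longleftrightarrow> (\<forall>x y. p (x + y) \<le> p x + p y) \<and> (\<forall>c x. c \<ge> 0 \<longrightarrow> p (c *\<^sub>R x) = c * p x)"

text \<open>One inequality for positive scalars is enough: applied to \<open>1 / c\<close> and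
  \<open>c *\<^sub>R x\<close>, it yields the reverse one.\<close>

lemma sublinearI:
  assumes "\<And>x y. p (x + y) \<le> p x + p y" "p 0 = 0"
    and "\<And>c x. c > 0 \<Longrightarrow> p (c *\<^sub>R x) \<le> c * p x"
  shows "sublinear p"
  unfolding sublinear_def
proof (intro conjI allI impI)
  fix c :: real and x assume "c \<ge> 0"
  show "p (c *\<^sub>R x) = c * p x"
  proof (cases "c = 0")
    case False
    with \<open>c \<ge> 0\<close> have c: "c > 0" by simp
    then have "p ((1 / c) *\<^sub>R (c *\<^sub>R x)) \<le> (1 / c) * p (c *\<^sub>R x)"
      by (intro assms(3)) simp
    with c have "c * p x \<le> p (c *\<^sub>R x)" by (simp add: field_simps)
    with assms(3)[OF c] show ?thesis by (simp add: antisym)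
  qed (simp add: assms(2))
qed (rule assms(1))

lemma sublinear_add: "sublinear p \<Longrightarrow> p (x + y) \<le> p x + p y"
  by (simp add: sublinear_def)

lemma sublinear_scale: "sublinear p \<Longrightarrow> c \<ge> 0 \<Longrightarrow> p (c *\<^sub>R x) = c * p x"
  by (simp add: sublinear_def)

lemma sublinear_zero: "sublinear p \<Longrightarrow> p 0 = 0"
  using sublinear_scale[of p 0 0] by simp

lemma sublinear_minus: "sublinear p \<Longrightarrow> - p (- x) \<le> p x"
  using sublinear_add[of p x "- x"] sublinear_zero[of p] by simp

text \<open>The functional \<open>q\<close> pushes \<open>p\<close> down so that
  \<open>q (- y)\<close> is at most \<open>- p y\<close>. If \<open>p\<close> is minimal, then
  \<open>q = p\<close>, and the last bound turns subadditivity into additivity.\<close>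

lemma sublinear_lower:
  fixes p :: "'a::real_vector \<Rightarrow> real"
  assumes p: "sublinear p"
  obtains q where "sublinear q" "\<And>x. q x \<le> p x" "\<And>x. q x \<le> p (x + y) - p y"
proof
  define q where "q x = (INF t\<in>{0..}. p (x + t *\<^sub>R y) - t * p y)" for x
  \<comment> \<open>The bound comes from splitting \<open>t *\<^sub>R y\<close> as
    \<open>(x + t *\<^sub>R y) + (- x)\<close>.\<close>
  have bdd: "bdd_below ((\<lambda>t. p (x + t *\<^sub>R y) - t * p y) ` {0..})" for x
  proof (rule bdd_belowI2)
    fix t :: real assume "t \<in> {0..}"
    then have "t * p y \<le> p (x + t *\<^sub>R y) + p (- x)"
      using sublinear_add[OF p, of "x + t *\<^sub>R y" "- x"] sublinear_scale[OF p, of t y] by simp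
    then show "- p (- x) \<le> p (x + t *\<^sub>R y) - t * p y" by simp
  qed
  have le: "q x \<le> p (x + t *\<^sub>R y) - t * p y" if "t \<ge> 0" for x t
    unfolding q_def using that by (intro cINF_lower bdd) simp
  have ge: "u \<le> q x" if "\<And>t. t \<ge> 0 \<Longrightarrow> u \<le> p (x + t *\<^sub>R y) - t * p y" for u x
    unfolding q_def using that by (intro cINF_greatest) auto
  show "q x \<le> p x" for x using le[of 0 x] by simp
  show "q x \<le> p (x + y) - p y" for x using le[of 1 x] by simp
  show "sublinear q"
  proof (rule sublinearI)
    fix x x'
    \<comment> \<open>The parameters \<open>t\<close> and \<open>t'\<close> for the two summands
      combine to \<open>t + t'\<close> for the sum; the infima are then taken one variable at a
      time.\<close>
    have "q (x + x') - (p (x' + t' *\<^sub>R y) - t' * p y) \<le> p (x + t *\<^sub>R y) - t * p y"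
      if "t \<ge> 0" "t' \<ge> 0" for t t'
      using le[of "t + t'" "x + x'"] that sublinear_add[OF p, of "x + t *\<^sub>R y" "x' + t' *\<^sub>R y"]
      by (simp add: algebra_simps)
    then have "q (x + x') - (p (x' + t' *\<^sub>R y) - t' * p y) \<le> q x" if "t' \<ge> 0" for t'
      using that by (intro ge) auto
    then have "q (x + x') - q x \<le> q x'"
      by (intro ge) (simp add: algebra_simps)
    then show "q (x + x') \<le> q x + q x'" by simp
  next
    have "0 \<le> q 0" by (rule ge) (simp add: sublinear_scale[OF p])
    with le[of 0 0] show "q 0 = 0" by (simp add: sublinear_zero[OF p])
  next
    fix c :: real and x assume c: "c > 0"
    have "q (c *\<^sub>R x) / c \<le> q x"
    proof (rule ge)
      fix t :: real assume "t \<ge> 0"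
      with c le[of "c * t" "c *\<^sub>R x"] sublinear_scale[OF p, of c "x + t *\<^sub>R y"]
      show "q (c *\<^sub>R x) / c \<le> p (x + t *\<^sub>R y) - t * p y"
        by (simp add: field_simps scaleR_add_right)
    qed
    with c show "q (c *\<^sub>R x) \<le> c * q x" by (simp add: field_simps)
  qed
qed

text \<open>The common majorant \<open>p\<close> keeps the infimum finite, since every
  \<open>q\<close> in \<open>Q\<close> satisfies \<open>- p (- x) \<le> - q (- x) \<le> q x\<close>.
  Subadditivity uses the chain: the smaller of \<open>q\<close> and \<open>r\<close> bounds both at
  once.\<close>

lemma sublinear_INF_chain:
  fixes p :: "'a::real_vector \<Rightarrow> real"
  assumes "Q \<noteq> {}" and Q: "\<And>q. q \<in> Q \<Longrightarrow> sublinear q" "\<And>q x. q \<in> Q \<Longrightarrow> q x \<le> p x"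
    and chain: "\<And>q r. q \<in> Q \<Longrightarrow> r \<in> Q \<Longrightarrow> q \<le> r \<or> r \<le> q"
  shows "sublinear (\<lambda>x. INF q\<in>Q. q x)" and "\<And>q x. q \<in> Q \<Longrightarrow> (INF q\<in>Q. q x) \<le> q x"
proof -
  define m where "m x = (INF q\<in>Q. q x)" for x
  have bdd: "bdd_below ((\<lambda>q. q x) ` Q)" for x
  proof (rule bdd_belowI2)
    fix q assume "q \<in> Q"
    with Q(2)[of q "- x"] sublinear_minus[OF Q(1), of q x] show "- p (- x) \<le> q x" by simp
  qed
  have le: "m x \<le> q x" if "q \<in> Q" for q x
    unfolding m_def using that by (intro cINF_lower bdd)
  then show "\<And>q x. q \<in> Q \<Longrightarrow> (INF q\<in>Q. q x) \<le> q x" by (simp add: m_def)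
  have ge: "u \<le> m x" if "\<And>q. q \<in> Q \<Longrightarrow> u \<le> q x" for u x
    unfolding m_def using that \<open>Q \<noteq> {}\<close> by (intro cINF_greatest) auto
  have "sublinear m"
  proof (rule sublinearI)
    fix x y
    have "m (x + y) \<le> q x + r y" if qr: "q \<in> Q" "r \<in> Q" for q r
    proof -
      from chain[OF qr] obtain s where "s \<in> Q" "s x \<le> q x" "s y \<le> r y"
        using qr by (auto simp: le_fun_def)
      with le[of s "x + y"] sublinear_add[OF Q(1), of s x y] show ?thesis by linarith
    qed
    then have "m (x + y) - r y \<le> m x" if "r \<in> Q" for r
      using that by (intro ge) (simp add: algebra_simps)
    then have "m (x + y) - m x \<le> m y"
      by (intro ge) (simp add: algebra_simps)
    then show "m (x + y) \<le> m x + m y" by simp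
  next
    obtain q where q: "q \<in> Q" using \<open>Q \<noteq> {}\<close> by auto
    then have "m 0 \<le> 0" using le[of q 0] sublinear_zero[OF Q(1)[OF q]] by simp
    moreover have "0 \<le> m 0" by (rule ge) (simp add: sublinear_zero Q)
    ultimately show "m 0 = 0" by simp
  next
    fix c :: real and x assume c: "c > 0"
    have "m (c *\<^sub>R x) / c \<le> m x"
    proof (rule ge)
      fix q assume "q \<in> Q"
      with c le[of q "c *\<^sub>R x"] sublinear_scale[OF Q(1), of q c x]
      show "m (c *\<^sub>R x) / c \<le> q x" by (simp add: field_simps)
    qed
    with c show "m (c *\<^sub>R x) \<le> c * m x" by (simp add: field_simps)
  qed
  then show "sublinear (\<lambda>x. INF q\<in>Q. q x)" by (simp add: m_def[abs_def])
qed

text \<open>Zorn's lemma for the reversed pointwise order, in which the pointwise infimum of a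
  nonempty chain is an upper bound.\<close>

lemma sublinear_minimal:
  fixes p :: "'a::real_vector \<Rightarrow> real"
  assumes p: "sublinear p"
  obtains g where "sublinear g" "g \<le> p" "\<And>q. sublinear q \<Longrightarrow> q \<le> g \<Longrightarrow> q = g"
proof -
  define S where "S = {q. sublinear q \<and> q \<le> p}"
  have "\<exists>g\<in>S. \<forall>q\<in>S. g \<ge> q \<longrightarrow> q = g"
  proof (rule predicate_Zorn)
    show "partial_order_on S (relation_of (\<ge>) S)"
      by (rule partial_order_on_relation_ofI) auto
  next
    fix Q assume "Q \<in> Chains (relation_of (\<ge>) S)"
    then have QS: "Q \<subseteq> S" and chain: "\<And>q r. q \<in> Q \<Longrightarrow> r \<in> Q \<Longrightarrow> q \<le> r \<or> r \<le> q"
      by (auto simp: Chains_def relation_of_def)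
    show "\<exists>u\<in>S. \<forall>a\<in>Q. a \<ge> u"
    \<comment> \<open>The infimum of an empty set of reals is of no use, so \<open>p\<close> itself
      bounds the empty chain.\<close>
    proof (cases "Q = {}")
      case True
      with p show ?thesis by (auto simp: S_def)
    next
      case False
      from QS have Q: "\<And>q. q \<in> Q \<Longrightarrow> sublinear q" "\<And>q x. q \<in> Q \<Longrightarrow> q x \<le> p x"
        by (auto simp: S_def le_fun_def)
      have inf: "sublinear (\<lambda>x. INF q\<in>Q. q x)" "\<And>q x. q \<in> Q \<Longrightarrow> (INF q\<in>Q. q x) \<le> q x"
        using sublinear_INF_chain[where p = p and Q = Q] False Q chain by simp_all
      from False obtain q where "q \<in> Q" by auto
      with inf(2) Q(2) have "(INF q\<in>Q. q x) \<le> p x" for x by (meson order_trans)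
      with inf show ?thesis
        by (intro bexI[of _ "\<lambda>x. INF q\<in>Q. q x"]) (auto simp: S_def le_fun_def)
    qed
  qed
  then show ?thesis using that unfolding S_def by (blast intro: order_trans)
qed

text \<open>Lowering \<open>p\<close> in direction \<open>e\<close> before minimizing fixes the
  value at \<open>e\<close>; minimality then makes \<open>g\<close> additive, hence odd and
  linear.\<close>

lemma sublinear_dominates_linear:
  fixes p :: "'a::real_vector \<Rightarrow> real"
  assumes p: "sublinear p"
  obtains g where "linear g" "\<And>x. g x \<le> p x" "g e = p e"
proof -
  obtain r where r: "sublinear r" "\<And>x. r x \<le> p x" "\<And>x. r x \<le> p (x + e) - p e"
    using sublinear_lower[OF p] by blast
  obtain g where g: "sublinear g" "g \<le> r" and min: "\<And>q. sublinear q \<Longrightarrow> q \<le> g \<Longrightarrow> q = g"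
    using sublinear_minimal[OF r(1)] by blast
  have add: "g (x + y) = g x + g y" for x y
  proof -
    obtain q where q: "sublinear q" "\<And>x. q x \<le> g x" "\<And>x. q x \<le> g (x + y) - g y"
      using sublinear_lower[OF g(1)] by blast
    with min[of q] have "q = g" by (simp add: le_fun_def)
    with q(3)[of x] sublinear_add[OF g(1), of x y] show ?thesis by simp
  qed
  have neg: "g (- x) = - g x" for x
    using add[of x "- x"] sublinear_zero[OF g(1)] by simp
  have "linear g"
  proof (rule linearI)
    fix c :: real and x
    show "g (c *\<^sub>R x) = c *\<^sub>R g x"
    proof (cases "c \<ge> 0")
      case False
      then have "g ((- c) *\<^sub>R x) = (- c) * g x" by (intro sublinear_scale[OF g(1)]) simp
      with neg[of "c *\<^sub>R x"] show ?thesis by simp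
    qed (simp add: sublinear_scale[OF g(1)])
  qed (rule add)
  moreover have le: "g x \<le> p x" for x
    using g(2) r(2) by (meson le_funD order_trans)
  \<comment> \<open>At \<open>- e\<close> the bound on \<open>r\<close> reads
    \<open>r (- e) \<le> - p e\<close>, so oddness of \<open>g\<close> gives
    \<open>g e \<ge> p e\<close>.\<close>
  moreover have "g e = p e"
    using le_funD[OF g(2), of "- e"] r(3)[of "- e"] sublinear_zero[OF p] neg[of e] le[of e] by simp
  ultimately show ?thesis by (rule that)
qed

section \<open>Separation of the origin from an open convex set\<close>

text \<open>The sublinear functional measuring the distance from \<open>- x\<close> to the cone spanned by \<open>N\<close>.\<close>

lemma sublinear_cone_dist:
  fixes N :: "'a::real_normed_vector set"
  assumes "convex N" "N \<noteq> {}"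
  obtains p where "sublinear p" "\<And>x t n. t \<ge> 0 \<Longrightarrow> n \<in> N \<Longrightarrow> p x \<le> norm (x + t *\<^sub>R n)"
    "\<And>u x. (\<And>t n. t \<ge> 0 \<Longrightarrow> n \<in> N \<Longrightarrow> u \<le> norm (x + t *\<^sub>R n)) \<Longrightarrow> u \<le> p x"
proof -
  define p where "p x = (INF (t, n)\<in>{0..} \<times> N. norm (x + t *\<^sub>R n))" for x
  have le: "p x \<le> norm (x + t *\<^sub>R n)" if "t \<ge> 0" "n \<in> N" for x t n
  proof -
    have "p x \<le> (case (t, n) of (t, n) \<Rightarrow> norm (x + t *\<^sub>R n))"
      unfolding p_def using that by (intro cINF_lower bdd_belowI2[where m = 0]) auto
    then show ?thesis by simp
  qed
  have ge: "u \<le> p x" if "\<And>t n. t \<ge> 0 \<Longrightarrow> n \<in> N \<Longrightarrow> u \<le> norm (x + t *\<^sub>R n)" for u x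
    unfolding p_def using that assms(2) by (intro cINF_greatest) auto
  have "sublinear p"
  proof (rule sublinearI)
    fix x y
    have "p (x + y) \<le> norm (x + s *\<^sub>R m) + norm (y + t *\<^sub>R n)"
      if st: "s \<ge> 0" "t \<ge> 0" and mn: "m \<in> N" "n \<in> N" for s t m n
    proof -
      \<comment> \<open>By convexity the nonnegative multiples of points of \<open>N\<close> are
        closed under addition: \<open>k\<close> is the weighted mean of \<open>m\<close> and
        \<open>n\<close>, with weights proportional to \<open>s\<close> and
        \<open>t\<close>.\<close>
      obtain k where k: "k \<in> N" "(s + t) *\<^sub>R k = s *\<^sub>R m + t *\<^sub>R n"
      proof (cases "s + t = 0")
        case True
        with st have "s = 0" "t = 0" by auto
        with mn(1) show ?thesis by (intro that) auto
      next
        case False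
        with st mn have "(s / (s + t)) *\<^sub>R m + (t / (s + t)) *\<^sub>R n \<in> N"
          by (intro convexD[OF assms(1)]) (auto simp: add_divide_distrib[symmetric])
        with False show ?thesis by (intro that) (auto simp: scaleR_add_right)
      qed
      have "p (x + y) \<le> norm (x + y + (s + t) *\<^sub>R k)"
        using k(1) st by (intro le) auto
      also have "\<dots> = norm ((x + s *\<^sub>R m) + (y + t *\<^sub>R n))"
        by (simp only: k(2) ac_simps)
      also have "\<dots> \<le> norm (x + s *\<^sub>R m) + norm (y + t *\<^sub>R n)" by (rule norm_triangle_ineq)
      finally show ?thesis .
    qed
    then have "p (x + y) - norm (y + t *\<^sub>R n) \<le> p x" if "t \<ge> 0" "n \<in> N" for t n
      using that by (intro ge) (simp add: algebra_simps)
    then have "p (x + y) - p x \<le> p y"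
      by (intro ge) (simp add: algebra_simps)
    then show "p (x + y) \<le> p x + p y" by simp
  next
    obtain n where "n \<in> N" using assms(2) by auto
    then have "p 0 \<le> 0" using le[of 0 n 0] by simp
    moreover have "0 \<le> p 0" by (rule ge) simp
    ultimately show "p 0 = 0" by simp
  next
    fix c :: real and x assume c: "c > 0"
    have "p (c *\<^sub>R x) / c \<le> p x"
    proof (rule ge)
      fix t :: real and n assume "t \<ge> 0" "n \<in> N"
      with c have "p (c *\<^sub>R x) \<le> norm (c *\<^sub>R x + (c * t) *\<^sub>R n)"
        by (intro le) auto
      also have "\<dots> = norm (c *\<^sub>R (x + t *\<^sub>R n))" by (simp add: scaleR_add_right)
      also have "\<dots> = c * norm (x + t *\<^sub>R n)" using c by simp
      finally show "p (c *\<^sub>R x) / c \<le> norm (x + t *\<^sub>R n)" using c by (simp add: field_simps)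
    qed
    with c show "p (c *\<^sub>R x) \<le> c * p x" by (simp add: field_simps)
  qed
  from this le ge show ?thesis by (rule that)
qed

text \<open>Let \<open>p\<close> be the distance functional of the cone spanned by \<open>N\<close>,
  and \<open>g\<close> a linear functional below \<open>p\<close> that agrees with it at some
  \<open>e\<close> in \<open>N\<close>. As \<open>p (- n) \<le> 0\<close> on \<open>N\<close>,
  \<open>g\<close> is nonnegative there; \<open>p e > 0\<close> and openness of \<open>N\<close>
  make it strictly positive.\<close>

lemma open_convex_positive_functional:
  fixes N :: "'a::real_normed_vector set"
  assumes "open N" "convex N" "0 \<notin> N"
  obtains f :: "'a \<Rightarrow>\<^sub>L real" where "\<And>n. n \<in> N \<Longrightarrow> f n > 0"
proof (cases "N = {}")
  case False
  then obtain e where e: "e \<in> N" by auto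
  then obtain r where r: "r > 0" "ball e r \<subseteq> N"
    using \<open>open N\<close> open_contains_ball by blast
  obtain p where p: "sublinear p"
    and le: "\<And>x t n. t \<ge> 0 \<Longrightarrow> n \<in> N \<Longrightarrow> p x \<le> norm (x + t *\<^sub>R n)"
    and ge: "\<And>u x. (\<And>t n. t \<ge> 0 \<Longrightarrow> n \<in> N \<Longrightarrow> u \<le> norm (x + t *\<^sub>R n)) \<Longrightarrow> u \<le> p x"
    using sublinear_cone_dist[OF assms(2) False] by blast
  obtain g where g: "linear g" "\<And>x. g x \<le> p x" "g e = p e"
    using sublinear_dominates_linear[OF p] by blast
  have g_le: "g x \<le> norm x" for x
    using g(2)[of x] le[of 0 e x] e by simp
  have "bounded_linear g"
  proof (rule bounded_linear_intro)
    show "norm (g x) \<le> norm x * 1" for x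
      using g_le[of x] g_le[of "- x"] linear_neg[OF g(1), of x] by simp
  qed (simp_all add: linear_add[OF g(1)] linear_scale[OF g(1)])
  \<comment> \<open>If \<open>e + t *\<^sub>R n\<close> were shorter than \<open>r\<close>, then
    \<open>- (t *\<^sub>R n)\<close> would lie in the ball around \<open>e\<close>, hence in
    \<open>N\<close>, and \<open>0\<close> would be a convex combination of it and
    \<open>n\<close>.\<close>
  have "r \<le> p e"
  proof (rule ge, rule ccontr)
    fix t :: real and n assume t: "t \<ge> 0" and n: "n \<in> N" and "\<not> r \<le> norm (e + t *\<^sub>R n)"
    then have "- (t *\<^sub>R n) \<in> ball e r" by (simp add: dist_norm)
    with r have "- (t *\<^sub>R n) \<in> N" by auto
    with n t have "(t / (1 + t)) *\<^sub>R n + (1 / (1 + t)) *\<^sub>R (- (t *\<^sub>R n)) \<in> N"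
      by (intro convexD[OF assms(2)]) (auto simp: add_divide_distrib[symmetric] add.commute)
    with \<open>0 \<notin> N\<close> show False by simp
  qed
  with g r have ge_pos: "g e > 0" by simp
  have nonneg: "g n \<ge> 0" if "n \<in> N" for n
    using g(2)[of "- n"] le[of 1 n "- n"] that linear_neg[OF g(1), of n] by simp
  have "g n > 0" if n: "n \<in> N" for n
  proof -
    obtain s where s: "s > 0" "ball n s \<subseteq> N" using n \<open>open N\<close> open_contains_ball by blast
    \<comment> \<open>A step of size \<open>c\<close> from \<open>n\<close> against \<open>e\<close>
      stays in the ball around \<open>n\<close>, so nonnegativity at
      \<open>n - c *\<^sub>R e\<close> gives \<open>g n \<ge> c * g e\<close>. The summand
      \<open>1\<close> keeps the denominator positive.\<close>
    define c where "c = s / (2 * (norm e + 1))"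
    have c: "c > 0" using s by (simp add: c_def add_nonneg_pos)
    have "c * norm e < s"
    proof -
      have "c * norm e \<le> c * (norm e + 1)" using c by simp
      also have "\<dots> = s / 2" unfolding c_def by (simp add: field_simps add_nonneg_eq_0_iff)
      finally show ?thesis using s by simp
    qed
    then have "n - c *\<^sub>R e \<in> N" using s c by (intro subsetD[OF s(2)]) (simp add: dist_norm)
    from nonneg[OF this] have "c * g e \<le> g n"
      by (simp add: linear_diff[OF g(1)] linear_scale[OF g(1)])
    moreover have "c * g e > 0" using c ge_pos by simp
    ultimately show ?thesis by linarith
  qed
  then show ?thesis
    using that[of "Blinfun g"] by (simp add: bounded_linear_Blinfun_apply \<open>bounded_linear g\<close>)
qed (use that in auto)

section \<open>Weak \<open>K\<close>-compactness and cancellation of \<open>D\<close>\<close>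

lemma openin_weak_topology_greater:
  fixes f :: "'a::real_normed_vector \<Rightarrow>\<^sub>L real"
  shows "openin weak_topology {x. f x > c}"
proof -
  have "{x. f x > c} = f -` {c<..}" by auto
  then show ?thesis
    unfolding weak_topology_def
    by (intro topology_generated_by_Basis CollectI exI[of _ f] exI[of _ "{c<..}"]) auto
qed

text \<open>Since \<open>f\<close> is nonnegative on \<open>K\<close>, adding \<open>K\<close> to
  \<open>{x. f x > c}\<close> produces no smaller values. Without a minimum such sets would cover
  \<open>D\<close>, but a point minimizing \<open>f\<close> over the finite index set of a subcover
  escapes that subcover.\<close>

lemma weakly_K_compact_attains_min:
  fixes f :: "'a::real_normed_vector \<Rightarrow>\<^sub>L real"
  assumes D: "weakly_K_compact K D" and "0 \<in> K" and K: "\<And>k. k \<in> K \<Longrightarrow> f k \<ge> 0"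
  obtains d where "d \<in> D" "\<And>d'. d' \<in> D \<Longrightarrow> f d \<le> f d'"
proof -
  have "\<exists>d\<in>D. \<forall>d'\<in>D. f d \<le> f d'"
  proof (rule ccontr)
    assume "\<not> ?thesis"
    then have no_min: "\<And>d. d \<in> D \<Longrightarrow> \<exists>d'\<in>D. f d' < f d" by (meson not_le)
    define W where "W d = {x. f x > f d} + K" for d
    have "W ` D \<subseteq> {U + K | U. openin weak_topology U}"
      using openin_weak_topology_greater by (auto simp: W_def)
    moreover have "D \<subseteq> \<Union>(W ` D)"
    proof
      fix d assume "d \<in> D"
      then obtain d' where "d' \<in> D" "f d' < f d" using no_min by blast
      moreover from this \<open>0 \<in> K\<close> have "d + 0 \<in> W d'"
        unfolding W_def by (intro set_plus_intro) auto
      ultimately show "d \<in> \<Union>(W ` D)" by auto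
    qed
    ultimately obtain \<F> where "\<F> \<subseteq> W ` D" "finite \<F>" "D \<subseteq> \<Union>\<F>"
      using D unfolding weakly_K_compact_def by blast
    then obtain F where F: "F \<subseteq> D" "finite F" "D \<subseteq> \<Union>(W ` F)"
      by (metis finite_subset_image)
    have "D \<noteq> {}" using D by (simp add: weakly_K_compact_def)
    with F have "F \<noteq> {}" by auto
    then obtain d where d: "d \<in> F" "\<And>d'. d' \<in> F \<Longrightarrow> f d \<le> f d'"
      using F(2) arg_min_if_finite[of F f] by (meson not_le)
    with F obtain d' where d': "d' \<in> F" "d \<in> W d'" by blast
    then obtain x k where "d = x + k" "f x > f d'" "k \<in> K"
      by (auto simp: W_def elim!: set_plus_elim)
    with K[of k] d(2)[OF d'(1)] show False by (simp add: blinfun.add_right)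
  qed
  then show ?thesis using that by blast
qed

text \<open>A cancellation law for a single translate: \<open>D\<close> is removed from both sides
  at the price of replacing \<open>B\<close> by its convex hull.\<close>

lemma add_subset_imp_mem_convex_hull_add_cone:
  fixes K B D :: "'a::real_normed_vector set"
  assumes K: "convex K" "cone K" "0 \<in> K" and B: "open B" "B \<noteq> {}"
    and D: "weakly_K_compact K D" and sub: "\<And>d. d \<in> D \<Longrightarrow> z + d \<in> D + B + K"
  shows "z \<in> convex hull B + K"
proof (rule ccontr)
  assume z: "z \<notin> convex hull B + K"
  define N where "N = (\<lambda>x. x - z) ` (convex hull B + K)"
  \<comment> \<open>The sum is a union of translates of an open set.\<close>
  have "open (convex hull B + K)"
  proof -
    have "convex hull B + K = (\<Union>k\<in>K. (+) k ` (convex hull B))"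
      by (subst add.commute) (auto simp: set_plus_def)
    then show ?thesis
      using open_convex_hull[OF B(1)] by (auto intro!: open_UN open_translation)
  qed
  then have "open N" unfolding N_def by (rule open_translation_subtract)
  moreover have "convex N"
    unfolding N_def using K by (intro convex_translation_subtract convex_set_plus) auto
  moreover have "0 \<notin> N" using z by (auto simp: N_def)
  ultimately obtain f :: "'a \<Rightarrow>\<^sub>L real" where f: "\<And>n. n \<in> N \<Longrightarrow> f n > 0"
    by (rule open_convex_positive_functional) blast
  have f_z: "f z < f b + f k" if "b \<in> B" "k \<in> K" for b k
  proof -
    have "b + k - z \<in> N"
      unfolding N_def using that by (auto intro: hull_inc)
    from f[OF this] show ?thesis by (simp add: blinfun.add_right blinfun.diff_right)
  qed
  obtain b\<^sub>0 where b\<^sub>0: "b\<^sub>0 \<in> B" using B by auto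
  have f_K: "f k \<ge> 0" if k: "k \<in> K" for k
  proof (rule ccontr)
    assume neg: "\<not> ?thesis"
    \<comment> \<open>This \<open>t\<close> solves \<open>f b\<^sub>0 + t * f k = f z\<close>, which
      contradicts the strict inequality \<open>f_z\<close> at \<open>t *\<^sub>R k\<close>.\<close>
    define t where "t = (f z - f b\<^sub>0) / f k"
    have "f z < f b\<^sub>0" using f_z[OF b\<^sub>0 \<open>0 \<in> K\<close>] by simp
    with neg have "t \<ge> 0" by (simp add: t_def divide_nonpos_neg)
    with k \<open>cone K\<close> have "t *\<^sub>R k \<in> K" by (simp add: cone_def)
    from f_z[OF b\<^sub>0 this] neg show False by (simp add: blinfun.scaleR_right t_def)
  qed
  obtain d where d: "d \<in> D" "\<And>d'. d' \<in> D \<Longrightarrow> f d \<le> f d'"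
    using weakly_K_compact_attains_min[OF D \<open>0 \<in> K\<close> f_K] by blast
  obtain d' b k where "z + d = d' + b + k" "d' \<in> D" "b \<in> B" "k \<in> K"
    using sub[OF d(1)] by (auto elim!: set_plus_elim)
  moreover from this(1) have "f z + f d = f d' + f b + f k"
    by (simp flip: blinfun.add_right)
  ultimately show False using d(2)[of d'] f_z[of b k] by simp
qed

theorem proposition2p10:
  fixes K A B C D :: "'a::real_normed_vector set"
  assumes "closed K" "convex K" "cone K" "pointed K"
    and "A \<noteq> {}" "B \<noteq> {}" "C \<noteq> {}" "D \<noteq> {}"
    and "weakly_K_compact K D"
    and "open B"
    and "A + C \<subseteq> D + B + K"
  shows "A + minkowski_diff C D \<subseteq> convex hull B + K"
proof
  fix z assume "z \<in> A + minkowski_diff C D"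
  then obtain a x where z: "z = a + x" "a \<in> A" "x \<in> minkowski_diff C D"
    by (rule set_plus_elim)
  \<comment> \<open>Regrouping \<open>z + d\<close> as \<open>a + (x + d)\<close> puts it in
    \<open>A + C\<close>.\<close>
  have "z + d \<in> D + B + K" if "d \<in> D" for d
  proof -
    have "x + d \<in> C" using z(3) that by (auto simp: minkowski_diff_def)
    with z(2) have "a + (x + d) \<in> A + C" by (rule set_plus_intro)
    with assms(11) show ?thesis by (auto simp: z(1) add.assoc)
  qed
  moreover have "0 \<in> K" using \<open>pointed K\<close> by (auto simp: pointed_def)
  ultimately show "z \<in> convex hull B + K"
    using assms by (intro add_subset_imp_mem_convex_hull_add_cone)
qed

end
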